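(* Let $n\geq 2$ and $v\geq 2$ be integers. Then the graph $\Gamma'(n,v)$ defined below is weakly $(n,v)$-clique-partitioned and has exactly $\binom{nv}{2}-\frac{n(n-1)v}{2}$ edges; hence the upper bound $\binom{nv}{2}-\frac{n(n-1)v}{2}$ on the number of edges of a weakly $(n,v)$-clique-partitioned graph is attained.
   Context: The graph $\Gamma'(n,v)$ has vertex set $\{(i,j):0\leq i\leq n-1,\ 0\leq j\leq v-1\}$ and is obtained from the complete graph on this vertex set by removing all edges joining $(i,0)$ to $(k,\ell)$ for all $i=0,1,\ldots,n-2$, all $k=i+1,\ldots,n-1$ and all $\ell=0,1,\ldots,v-1$. A $v$-clique is a set of $v$ pairwise adjacent vertices. A graph of order $nv$ is weakly $(n,v)$-clique-partitioned if its vertex set can be decomposed in a unique way into $n$ vertex-disjoint $v$-cliques. *)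

theory Defs
  imports Complex_Main "HOL-Library.Ramsey" "HOL-Library.Disjoint_Sets"
begin

text \<open>A finite simple graph is given by its vertex set \<open>V\<close> and its edge set \<open>E\<close>,
  whose elements are two-element subsets of \<open>V\<close>.\<close>

definition simple_graph :: "'a set \<Rightarrow> 'a set set \<Rightarrow> bool" where
  "simple_graph V E \<longleftrightarrow> finite V \<and> E \<subseteq> [V]\<^bsup>2\<^esup>"

text \<open>The constant \<open>clique\<close> below is the one of the Ramsey library theory: pairwise adjacent
  vertices, not necessarily a maximal such set.\<close>

definition clique_decomposition ::
  "nat \<Rightarrow> nat \<Rightarrow> 'a set \<Rightarrow> 'a set set \<Rightarrow> 'a set set \<Rightarrow> bool" where
  "clique_decomposition n v V E P \<longleftrightarrow>
     partition_on V P \<and> card P = n \<and> (\<forall>C\<in>P. card C = v \<and> clique C E)"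

definition weakly_clique_partitioned ::
  "nat \<Rightarrow> nat \<Rightarrow> 'a set \<Rightarrow> 'a set set \<Rightarrow> bool" where
  "weakly_clique_partitioned n v V E \<longleftrightarrow>
     simple_graph V E \<and> card V = n * v \<and> (\<exists>!P. clique_decomposition n v V E P)"

definition Gamma'_verts :: "nat \<Rightarrow> nat \<Rightarrow> (nat \<times> nat) set" where
  "Gamma'_verts n v = {..<n} \<times> {..<v}"

definition Gamma'_edges :: "nat \<Rightarrow> nat \<Rightarrow> (nat \<times> nat) set set" where
  "Gamma'_edges n v =
     [Gamma'_verts n v]\<^bsup>2\<^esup> - {{(i, 0), (k, l)} | i k l. i < k \<and> k < n \<and> l < v}"

end

theory Submission
  imports Defs "HOL-Combinatorics.Transposition"
begin

text \<open>
  For the bound, let \<open>C\<close> and \<open>D\<close> be two blocks of the unique decomposition. If fewer than \<open>v\<close>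
  non-edges joined them, some \<open>x \<in> C\<close> would be adjacent to all of \<open>D\<close> and some \<open>y \<in> D\<close>
  adjacent to all of \<open>C\<close>; exchanging \<open>x\<close> and \<open>y\<close> would then give a second decomposition.
  Hence each of the \<open>n choose 2\<close> pairs of blocks accounts for at least \<open>v\<close> non-edges.

  In \<open>\<Gamma>'(n,v)\<close> the vertex \<open>(i,0)\<close> has no neighbours in later rows, so by induction on \<open>i\<close> the
  block containing it is row \<open>i\<close>.
\<close>

section \<open>Counting pairs\<close>

lemma real_choose_two: "real (n choose 2) = real n * (real n - 1) / 2"
  by (induction n) (simp_all add: numeral_2_eq_2 field_simps)

lemma sum_lessThan_eq_choose_two: "(\<Sum>k<n. k) = n choose 2"
  by (induction n) (simp_all add: numeral_2_eq_2)

lemma card_nsets: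
  assumes "finite A"
  shows "card ([A]\<^bsup>k\<^esup>) = card A choose k"
proof -
  have "[A]\<^bsup>k\<^esup> = {B. B \<subseteq> A \<and> card B = k}"
    using assms by (auto simp: nsets_def intro: finite_subset)
  then show ?thesis using assms by (simp add: n_subsets)
qed

lemma partition_on_block_unique:
  assumes "partition_on V P" "C \<in> P" "D \<in> P" "x \<in> C" "x \<in> D"
  shows "C = D"
  using assms partition_onD2 disjointD by blast

section \<open>The upper bound: non-edges between two blocks\<close>

text \<open>Indexing by the exact set \<open>Q\<close> of blocks met makes the families for
  different \<open>Q\<close> disjoint by construction. For distinct blocks \<open>C\<close>,
  \<open>D\<close> of a partition \<open>P\<close> of \<open>V\<close>, the choice
  \<open>Q = {C, D}\<close> gives the non-edges with one end in each.\<close>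

definition nonedges_meeting :: "'a set \<Rightarrow> 'a set set \<Rightarrow> 'a set set \<Rightarrow> 'a set set \<Rightarrow> 'a set set" where
  "nonedges_meeting V E P Q = {e \<in> [V]\<^bsup>2\<^esup> - E. {X\<in>P. e \<inter> X \<noteq> {}} = Q}"

lemma finite_nonedges_meeting: "finite V \<Longrightarrow> finite (nonedges_meeting V E P Q)"
  unfolding nonedges_meeting_def by (simp add: finite_imp_finite_nsets)

text \<open>A non-edge between \<open>C\<close> and \<open>D\<close> has only one end in
  \<open>C\<close>. If every vertex of \<open>C\<close> lay on such a non-edge, choosing one for
  each vertex would give \<open>card C\<close> different ones.\<close>

lemma ex_vertex_avoiding_nonedges:
  assumes P: "partition_on V P" and V: "finite V"
    and CD: "C \<in> P" "D \<in> P" "C \<noteq> D"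
    and few: "card (nonedges_meeting V E P {C, D}) < card C"
  obtains x where "x \<in> C" "\<And>d. d \<in> D \<Longrightarrow> {x, d} \<in> E"
proof -
  let ?N = "nonedges_meeting V E P {C, D}"
  have fin: "finite ?N"
    using V by (rule finite_nonedges_meeting)
  have "\<exists>x\<in>C. \<forall>e\<in>?N. x \<notin> e"
  proof (rule ccontr)
    assume "\<not> ?thesis"
    then obtain g where g: "\<And>x. x \<in> C \<Longrightarrow> g x \<in> ?N \<and> x \<in> g x"
      by (metis (no_types))
    \<comment> \<open>A non-edge chosen for two vertices of \<open>C\<close> would consist of just
      these two and so could not meet \<open>D\<close>.\<close>
    have "inj_on g C"
    proof (rule inj_onI, rule ccontr)
      fix x y assume xy: "x \<in> C" "y \<in> C" "g x = g y" "x \<noteq> y"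
      then have "card (g x) = 2" "x \<in> g x" "y \<in> g x"
        using g[of x] g[of y] by (auto simp: nonedges_meeting_def nsets_def)
      then have "g x = {x, y}"
        using xy(4) by (auto simp: card_2_iff)
      moreover have "D \<in> {X\<in>P. g x \<inter> X \<noteq> {}}"
        using g[OF xy(1)] by (simp add: nonedges_meeting_def)
      then have "g x \<inter> D \<noteq> {}" by simp
      ultimately obtain d where "d \<in> D" "d \<in> C" using xy by auto
      then show False
        using CD partition_on_block_unique[OF P] by metis
    qed
    then have "card C \<le> card ?N"
      using g fin by (intro card_inj_on_le[of g]) auto
    with few show False by simp
  qed
  then obtain x where x: "x \<in> C" "\<And>e. e \<in> ?N \<Longrightarrow> x \<notin> e" by blast
  have "{x, d} \<in> E" if d: "d \<in> D" for d
  proof (rule ccontr)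
    assume nE: "{x, d} \<notin> E"
    have "x \<noteq> d" using x(1) d CD partition_on_block_unique[OF P] by metis
    moreover have "x \<in> V" "d \<in> V" using x(1) d CD partition_onD1[OF P] by auto
    moreover have "{X\<in>P. {x, d} \<inter> X \<noteq> {}} = {C, D}"
    proof -
      have "X = C" if "X \<in> P" "x \<in> X" for X
        using that x(1) CD(1) partition_on_block_unique[OF P] by metis
      moreover have "X = D" if "X \<in> P" "d \<in> X" for X
        using that d CD(2) partition_on_block_unique[OF P] by metis
      ultimately show ?thesis using x(1) d CD(1,2) by fast
    qed
    ultimately have "{x, d} \<in> ?N"
      using nE by (simp add: nonedges_meeting_def)
    then show False using x(2) by blast
  qed
  with x(1) that show ?thesis by blast
qed

lemma clique_transpose_image:
  assumes "clique C E" "x \<in> C" "y \<notin> C" "\<And>c. c \<in> C \<Longrightarrow> {y, c} \<in> E"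
  shows "clique (Transposition.transpose x y ` C) E"
proof -
  have "Transposition.transpose x y ` C = insert y (C - {x})"
    using assms by (auto simp: transpose_def image_iff split: if_splits)
  then show ?thesis
    using assms by (auto simp: clique_def insert_commute)
qed

text \<open>Writing the exchange as the image under a bijection of \<open>V\<close> preserves the
  partition, the number of blocks and their sizes. Only \<open>C\<close> and \<open>D\<close>
  change, so only there must the clique property be checked anew.\<close>

lemma clique_decomposition_exchange:
  assumes dec: "clique_decomposition n v V E P"
    and CD: "C \<in> P" "D \<in> P" "C \<noteq> D"
    and xy: "x \<in> C" "y \<in> D"
    and adj: "\<And>d. d \<in> D \<Longrightarrow> {x, d} \<in> E" "\<And>c. c \<in> C \<Longrightarrow> {y, c} \<in> E"
  shows "clique_decomposition n v V E ((`) (Transposition.transpose x y) ` P)"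
proof -
  let ?t = "Transposition.transpose x y"
  have P: "partition_on V P" and card_P: "card P = n"
    and blocks: "\<And>X. X \<in> P \<Longrightarrow> card X = v \<and> clique X E"
    using dec by (auto simp: clique_decomposition_def)
  note uniq = partition_on_block_unique[OF P]
  have "x \<in> V" "y \<in> V" using xy CD partition_onD1[OF P] by auto
  then have "?t ` V = V" by simp
  moreover have "{} \<notin> (`) ?t ` P" using partition_onD3[OF P] by auto
  ultimately have "partition_on V ((`) ?t ` P)"
    using partition_on_inj_image[OF P, of ?t] by simp
  moreover have "card ((`) ?t ` P) = n"
    using card_P by (subst card_image) (auto intro!: inj_onI simp: inj_image_eq_iff)
  moreover have "card (?t ` X) = v \<and> clique (?t ` X) E" if X: "X \<in> P" for X
  proof
    show "card (?t ` X) = v" using blocks[OF X] by (simp add: card_image)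
    consider "X = C" | "X = D" | "x \<notin> X" "y \<notin> X" using uniq X xy CD by blast
    then show "clique (?t ` X) E"
    proof cases
      case 1
      then show ?thesis
        using clique_transpose_image[of C E x y] blocks[OF X] xy CD adj uniq by blast
    next
      case 2
      then show ?thesis
        using clique_transpose_image[of D E y x] blocks[OF X] xy CD adj uniq
        by (metis transpose_commute)
    next
      case 3
      then show ?thesis using blocks[OF X] by simp
    qed
  qed
  ultimately show ?thesis by (auto simp: clique_decomposition_def)
qed

lemma card_nonedges_meeting_ge:
  assumes V: "finite V" and v: "v \<ge> 2"
    and dec: "clique_decomposition n v V E P"
    and unique: "\<And>P'. clique_decomposition n v V E P' \<Longrightarrow> P' = P"
    and CD: "C \<in> P" "D \<in> P" "C \<noteq> D"
  shows "v \<le> card (nonedges_meeting V E P {C, D})"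
proof (rule ccontr)
  assume few: "\<not> ?thesis"
  have P: "partition_on V P" and card_C: "card C = v" and card_D: "card D = v"
    using dec CD by (auto simp: clique_decomposition_def)
  note uniq = partition_on_block_unique[OF P]
  obtain x where x: "x \<in> C" "\<And>d. d \<in> D \<Longrightarrow> {x, d} \<in> E"
    using ex_vertex_avoiding_nonedges[OF P V CD, of E] few card_C by auto
  obtain y where y: "y \<in> D" "\<And>c. c \<in> C \<Longrightarrow> {y, c} \<in> E"
    using ex_vertex_avoiding_nonedges[OF P V CD(2,1), of E] CD few card_D
    by (auto simp: insert_commute)
  let ?t = "Transposition.transpose x y"
  have "(`) ?t ` P = P"
    using unique clique_decomposition_exchange[OF dec CD x(1) y(1)] x y by blast
  then have tC: "?t ` C \<in> P" using CD by blast
  \<comment> \<open>As \<open>v\<close> is at least 2, \<open>C\<close> has a vertex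
    \<open>c\<close> other than \<open>x\<close>. The image of \<open>C\<close> contains both
    \<open>c\<close> and \<open>y\<close>, hence meets both \<open>C\<close> and \<open>D\<close>
    and cannot be a block of \<open>P\<close>.\<close>
  have "\<not> C \<subseteq> {x}"
    using card_mono[of "{x}" C] card_C v by auto
  then obtain c where c: "c \<in> C" "c \<noteq> x" by blast
  then have "c \<noteq> y" using y CD uniq by blast
  then have "c \<in> ?t ` C" "y \<in> ?t ` C"
    using c x by (auto simp: image_iff transpose_def)
  then show False using tC c y CD uniq by metis
qed

lemma card_nonedges_ge:
  assumes V: "finite V" and v: "v \<ge> 2" and n: "n \<ge> 1"
    and dec: "clique_decomposition n v V E P"
    and unique: "\<And>P'. clique_decomposition n v V E P' \<Longrightarrow> P' = P"
  shows "(n choose 2) * v \<le> card ([V]\<^bsup>2\<^esup> - E)"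
proof -
  have "card P = n" using dec by (simp add: clique_decomposition_def)
  \<comment> \<open>An infinite set has \<open>card\<close> 0, which \<open>n \<ge> 1\<close>
    excludes.\<close>
  then have fin: "finite P" using n card.infinite by fastforce
  have finN: "finite ([V]\<^bsup>2\<^esup> - E)" using V by (simp add: finite_imp_finite_nsets)
  have "(n choose 2) * v = (\<Sum>Q\<in>[P]\<^bsup>2\<^esup>. v)"
    using \<open>card P = n\<close> fin by (simp add: card_nsets)
  also have "\<dots> \<le> (\<Sum>Q\<in>[P]\<^bsup>2\<^esup>. card (nonedges_meeting V E P Q))"
    using card_nonedges_meeting_ge[OF V v dec unique]
    by (intro sum_mono) (auto simp: nsets_2_eq)
  also have "\<dots> = card (\<Union>Q\<in>[P]\<^bsup>2\<^esup>. nonedges_meeting V E P Q)"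
    using fin V
    by (intro card_UN_disjoint[symmetric])
      (simp_all add: finite_imp_finite_nsets finite_nonedges_meeting, auto simp: nonedges_meeting_def)
  also have "\<dots> \<le> card ([V]\<^bsup>2\<^esup> - E)"
    using finN by (intro card_mono) (auto simp: nonedges_meeting_def)
  finally show ?thesis .
qed

text \<open>The additive form avoids truncated subtraction on \<open>nat\<close>; the exact count
  \<open>card_Gamma'_edges\<close> has the same shape.\<close>

lemma weakly_clique_partitioned_card_edges_le:
  assumes "weakly_clique_partitioned n v V E" "n \<ge> 1" "v \<ge> 2"
  shows "card E + (n choose 2) * v \<le> (n * v) choose 2"
proof -
  have V: "finite V" and E: "E \<subseteq> [V]\<^bsup>2\<^esup>" and card_V: "card V = n * v"
    using assms by (auto simp: weakly_clique_partitioned_def simple_graph_def)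
  obtain P where "clique_decomposition n v V E P"
    "\<And>P'. clique_decomposition n v V E P' \<Longrightarrow> P' = P"
    using assms by (auto simp: weakly_clique_partitioned_def)
  from card_nonedges_ge[OF V assms(3,2) this]
  have le: "(n choose 2) * v \<le> card ([V]\<^bsup>2\<^esup> - E)" .
  have fin: "finite ([V]\<^bsup>2\<^esup>)" using V by (rule finite_imp_finite_nsets)
  have "card ([V]\<^bsup>2\<^esup> - E) = ((n * v) choose 2) - card E"
    using E fin V card_V by (simp add: card_Diff_subset finite_subset card_nsets)
  moreover have "card E \<le> (n * v) choose 2"
    using card_mono[OF fin E] V card_V by (simp add: card_nsets)
  ultimately show ?thesis using le by linarith
qed

section \<open>The number of edges of \<open>\<Gamma>'(n,v)\<close>\<close>

lemma card_Gamma'_edges: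
  assumes "v \<ge> 1"
  shows "card (Gamma'_edges n v) + (n choose 2) * v = (n * v) choose 2"
proof -
  let ?V = "Gamma'_verts n v"
  \<comment> \<open>The larger row \<open>k\<close> comes first, leaving \<open>k\<close> choices
    for \<open>i\<close>, so the size of \<open>?T\<close> is the sum of all \<open>k < n\<close>,
    times \<open>v\<close>.\<close>
  let ?T = "(SIGMA k:{..<n}. {..<k}) \<times> {..<v}"
  let ?R = "{{(i, 0), (k, l)} | i k l. i < k \<and> k < n \<and> l < v}"
  let ?f = "\<lambda>((k, i), l). {(i, 0), (k, l)} :: (nat \<times> nat) set"
  have fin: "finite ([?V]\<^bsup>2\<^esup>)" by (simp add: Gamma'_verts_def finite_imp_finite_nsets)
  have total: "card ([?V]\<^bsup>2\<^esup>) = (n * v) choose 2"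
    by (simp add: card_nsets Gamma'_verts_def)
  \<comment> \<open>Since \<open>i < k\<close>, the row numbers tell the two ends of an unordered
    pair apart.\<close>
  have "inj_on ?f ?T"
    by (rule inj_onI, clarify) (simp add: doubleton_eq_iff, linarith)
  moreover have "?f ` ?T = ?R"
  proof
    show "?f ` ?T \<subseteq> ?R" by auto
    show "?R \<subseteq> ?f ` ?T"
    proof clarify
      fix i k l assume "i < k" "k < n" "l < v"
      then show "{(i, 0), (k, l)} \<in> ?f ` ?T"
        by (intro image_eqI[of _ _ "((k, i), l)"]) auto
    qed
  qed
  ultimately have "card ?R = card ?T" using card_image[of ?f ?T] by simp
  then have card_R: "card ?R = (n choose 2) * v"
    by (simp add: card_cartesian_product sum_lessThan_eq_choose_two)
  have sub: "?R \<subseteq> [?V]\<^bsup>2\<^esup>"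
  proof clarify
    fix i k l assume "i < k" "k < n" "l < v"
    then show "{(i, 0), (k, l)} \<in> [?V]\<^bsup>2\<^esup>" by (simp add: Gamma'_verts_def)
  qed
  have "card (Gamma'_edges n v) = card ([?V]\<^bsup>2\<^esup>) - card ?R"
    unfolding Gamma'_edges_def using fin sub by (intro card_Diff_subset) (auto intro: finite_subset)
  moreover have "card ?R \<le> card ([?V]\<^bsup>2\<^esup>)" using card_mono[OF fin sub] .
  ultimately show ?thesis using card_R total by linarith
qed

section \<open>Existence and uniqueness of the decomposition of
  \<open>\<Gamma>'(n,v)\<close>\<close>

definition row :: "nat \<Rightarrow> nat \<Rightarrow> (nat \<times> nat) set" where
  "row v i = {i} \<times> {..<v}"

text \<open>Every removed edge joins two different rows, so each row stays complete.\<close>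

lemma clique_decomposition_rows:
  assumes "v \<ge> 1"
  shows "clique_decomposition n v (Gamma'_verts n v) (Gamma'_edges n v) (row v ` {..<n})"
  unfolding clique_decomposition_def
proof (intro conjI ballI)
  \<comment> \<open>The vertex \<open>(i, 0)\<close> marks its row: this yields both that rows are
    nonempty and that \<open>row v\<close> is injective.\<close>
  have mem: "(i, 0) \<in> row v j \<longleftrightarrow> i = j" for i j
    using assms by (auto simp: row_def)
  show "partition_on (Gamma'_verts n v) (row v ` {..<n})"
  proof (rule partition_onI)
    show "\<Union> (row v ` {..<n}) = Gamma'_verts n v"
      by (auto simp: Gamma'_verts_def row_def)
    show "{} \<notin> row v ` {..<n}"
      using mem by blast
  qed (auto simp: row_def disjnt_def)
  have "inj_on (row v) {..<n}"
    using mem by (intro inj_onI) metis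
  then show "card (row v ` {..<n}) = n" by (simp add: card_image)
next
  fix C assume "C \<in> row v ` {..<n}"
  then obtain i where i: "i < n" "C = row v i" by blast
  show "card C = v" using i by (simp add: row_def)
  show "clique C (Gamma'_edges n v)"
    using i by (auto simp: clique_def Gamma'_edges_def Gamma'_verts_def row_def doubleton_eq_iff)
qed

lemma Gamma'_rows_in_decomposition:
  assumes dec: "clique_decomposition n v (Gamma'_verts n v) (Gamma'_edges n v) P"
    and v: "v \<ge> 1"
  shows "i < n \<Longrightarrow> row v i \<in> P"
proof (induction i rule: less_induct)
  case (less i)
  have P: "partition_on (Gamma'_verts n v) P"
    and blocks: "\<And>X. X \<in> P \<Longrightarrow> card X = v \<and> clique X (Gamma'_edges n v)"
    using dec by (auto simp: clique_decomposition_def)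
  note uniq = partition_on_block_unique[OF P]
  have "(i, 0) \<in> Gamma'_verts n v" using less.prems v by (auto simp: Gamma'_verts_def)
  then obtain C where C: "C \<in> P" "(i, 0) \<in> C" using partition_onD1[OF P] by auto
  have "C \<subseteq> row v i"
  proof
    fix z assume z: "z \<in> C"
    obtain k l where kl: "z = (k, l)" by (cases z)
    have bounds: "k < n" "l < v"
      using z C partition_onD1[OF P] kl by (auto simp: Gamma'_verts_def)
    have "\<not> i < k"
    proof
      assume "i < k"
      then have "{(i, 0), (k, l)} \<in> Gamma'_edges n v"
        using blocks[OF C(1)] C(2) z kl by (auto simp: clique_def)
      then show False using \<open>i < k\<close> bounds by (auto simp: Gamma'_edges_def)
    qed
    \<comment> \<open>By induction the earlier row \<open>k\<close> is itself a block, so a block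
      meeting it equals it and misses \<open>(i, 0)\<close>.\<close>
    moreover have "\<not> k < i"
    proof
      assume "k < i"
      then have "row v k \<in> P" using less by simp
      moreover have "z \<in> row v k" using kl bounds by (simp add: row_def)
      ultimately have "C = row v k" using uniq C(1) z by blast
      then show False using C(2) \<open>k < i\<close> by (simp add: row_def)
    qed
    ultimately show "z \<in> row v i" using kl bounds by (simp add: row_def)
  qed
  \<comment> \<open>Both sets have \<open>v\<close> elements, so the inclusion is an
    equality.\<close>
  then have "C = row v i"
    using blocks[OF C(1)] by (intro card_subset_eq) (auto simp: row_def)
  with C show ?case by simp
qed

lemma weakly_clique_partitioned_Gamma':
  assumes "n \<ge> 1" "v \<ge> 1"
  shows "weakly_clique_partitioned n v (Gamma'_verts n v) (Gamma'_edges n v)"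
  unfolding weakly_clique_partitioned_def
proof (intro conjI ex1I)
  show "simple_graph (Gamma'_verts n v) (Gamma'_edges n v)"
    by (auto simp: simple_graph_def Gamma'_verts_def Gamma'_edges_def)
  show "card (Gamma'_verts n v) = n * v" by (simp add: Gamma'_verts_def)
  show rows: "clique_decomposition n v (Gamma'_verts n v) (Gamma'_edges n v) (row v ` {..<n})"
    using assms(2) by (rule clique_decomposition_rows)
  fix P assume dec: "clique_decomposition n v (Gamma'_verts n v) (Gamma'_edges n v) P"
  \<comment> \<open>Here too \<open>n \<ge> 1\<close> forces \<open>P\<close> to be finite; the
    \<open>n\<close> rows are then \<open>n\<close> of its \<open>n\<close> blocks, hence all of
    them.\<close>
  have card_P: "card P = n" using dec by (simp add: clique_decomposition_def)
  then have "finite P" using assms(1) card.infinite by fastforce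
  moreover have "row v ` {..<n} \<subseteq> P"
    using Gamma'_rows_in_decomposition[OF dec assms(2)] by blast
  moreover have "card (row v ` {..<n}) = card P"
    using rows card_P by (simp add: clique_decomposition_def)
  ultimately show "P = row v ` {..<n}" using card_subset_eq by metis
qed

theorem theorem3p2:
  fixes n v :: nat
  assumes "n \<ge> 2" and "v \<ge> 2"
  defines "B \<equiv> real ((n * v) choose 2) - real n * (real n - 1) * real v / 2"
  shows "weakly_clique_partitioned n v (Gamma'_verts n v) (Gamma'_edges n v)
    \<and> real (card (Gamma'_edges n v)) = B
    \<and> (\<forall>(V :: 'a set) E. weakly_clique_partitioned n v V E \<longrightarrow> real (card E) \<le> B)
    \<and> (\<exists>(V :: (nat \<times> nat) set) E. weakly_clique_partitioned n v V E \<and> real (card E) = B)"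
proof -
  have B: "B = real ((n * v) choose 2) - real ((n choose 2) * v)"
    by (simp add: B_def real_choose_two)
  have wcp: "weakly_clique_partitioned n v (Gamma'_verts n v) (Gamma'_edges n v)"
    using assms(1,2) by (intro weakly_clique_partitioned_Gamma') simp_all
  moreover have card_eq: "real (card (Gamma'_edges n v)) = B"
    using card_Gamma'_edges[of v n] assms(2) unfolding B by linarith
  moreover have "real (card E) \<le> B" if "weakly_clique_partitioned n v V E" for V :: "'a set" and E
    using weakly_clique_partitioned_card_edges_le[OF that] assms(1,2) unfolding B by linarith
  ultimately show ?thesis by blast
qed

end
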